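(* Suppose that $((\xi_j, X_{j+1}) : j \geq 0)$ is a sequence of i.i.d. random pairs (real-valued components), let $S_0=0$, $S_n = X_1+\cdots+X_n$ for $n\ge 1$, and let $M_\infty = \max\{S_k+\xi_k : k\ge 0\}$. For $g:\mathbb{R}\to\mathbb{R}^+$ define $$(Tg)(x) = \int_{\mathbb{R}} g(x-y)\,\mathbb{P}(\xi_0\le x,\ X_1\in dy), \qquad x\in\mathbb{R},$$ let $T^0$ be the identity operator, and let $T^{n+1}=T\circ T^n$ for $n\ge 0$. Let $b(x)=\mathbb{P}(\xi_0>x)$ and $u^*(x)=\mathbb{P}(M_\infty>x)$ for $x\in\mathbb{R}$. Then: (i) $u^*=(u^*(x):x\in\mathbb{R})$ satisfies the linear integral equation $u = b+Tu$. (ii) Furthermore, $u^*$ is given by $u^*=\sum_{n=0}^\infty T^n b$.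
   Context: For fixed $x$, $\mathbb{P}(\xi_0\le x, X_1\in dy)$ denotes the finite measure $B\mapsto \mathbb{P}(\xi_0\le x, X_1\in B)$ on the Borel sets of $\mathbb{R}$. Functions $g$ are Borel measurable and nonnegative. The maximum $M_\infty$ is understood as the supremum of $S_k+\xi_k$ over $k\ge0$ (possibly $+\infty$) when it is not attained. Within each pair, $\xi_j$ and $X_{j+1}$ may be dependent. *)

theory Defs
  imports "HOL-Probability.Probability"
begin

definition partial_sum :: "(nat \<Rightarrow> 'a \<Rightarrow> real) \<Rightarrow> nat \<Rightarrow> 'a \<Rightarrow> real" where
  "partial_sum X n \<omega> = (\<Sum>k = 1..n. X k \<omega>)"

definition perturbed_max :: "(nat \<Rightarrow> 'a \<Rightarrow> real) \<Rightarrow> (nat \<Rightarrow> 'a \<Rightarrow> real) \<Rightarrow> 'a \<Rightarrow> ereal" where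
  "perturbed_max \<xi> X \<omega> = (SUP k. ereal (partial_sum X k \<omega> + \<xi> k \<omega>))"

text \<open>
  The finite Borel measure that maps \<open>B\<close> to \<open>P(Z \<le> x, Y \<in> B)\<close>; see \<open>emeasure_joint_law\<close> below.
\<close>

definition joint_law :: "'a measure \<Rightarrow> ('a \<Rightarrow> real) \<Rightarrow> ('a \<Rightarrow> real) \<Rightarrow> real \<Rightarrow> real measure" where
  "joint_law M Z Y x = distr (restrict_space M {\<omega> \<in> space M. Z \<omega> \<le> x}) borel Y"

text \<open>
  Nonnegative functions take values in \<open>ennreal\<close>, so that the integral is meaningful
  also where it is infinite.
\<close>

definition T_op ::
  "'a measure \<Rightarrow> ('a \<Rightarrow> real) \<Rightarrow> ('a \<Rightarrow> real) \<Rightarrow> (real \<Rightarrow> ennreal) \<Rightarrow> real \<Rightarrow> ennreal" where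
  "T_op M Z Y g x = (\<integral>\<^sup>+ y. g (x - y) \<partial>joint_law M Z Y x)"

definition b_fun :: "'a measure \<Rightarrow> (nat \<Rightarrow> 'a \<Rightarrow> real) \<Rightarrow> real \<Rightarrow> ennreal" where
  "b_fun M \<xi> x = emeasure M {\<omega> \<in> space M. \<xi> 0 \<omega> > x}"

definition u_star ::
  "'a measure \<Rightarrow> (nat \<Rightarrow> 'a \<Rightarrow> real) \<Rightarrow> (nat \<Rightarrow> 'a \<Rightarrow> real) \<Rightarrow> real \<Rightarrow> ennreal" where
  "u_star M \<xi> X x = emeasure M {\<omega> \<in> space M. perturbed_max \<xi> X \<omega> > ereal x}"

lemma emeasure_joint_law:
  assumes [measurable]: "Z \<in> borel_measurable M" "Y \<in> borel_measurable M" "B \<in> sets borel"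
  shows "emeasure (joint_law M Z Y x) B = emeasure M {\<omega> \<in> space M. Z \<omega> \<le> x \<and> Y \<omega> \<in> B}"
proof -
  let ?A = "{\<omega> \<in> space M. Z \<omega> \<le> x}"
  have "Y \<in> borel_measurable (restrict_space M ?A)"
    by (intro measurable_restrict_space1) measurable
  then have "emeasure (joint_law M Z Y x) B
      = emeasure (restrict_space M ?A) (Y -` B \<inter> space (restrict_space M ?A))"
    unfolding joint_law_def by (simp add: emeasure_distr)
  also have "\<dots> = emeasure M (Y -` B \<inter> space (restrict_space M ?A))"
    by (rule emeasure_restrict_space) (auto simp: space_restrict_space)
  also have "Y -` B \<inter> space (restrict_space M ?A) = {\<omega> \<in> space M. Z \<omega> \<le> x \<and> Y \<omega> \<in> B}"
    by (auto simp: space_restrict_space)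
  finally show ?thesis .
qed

lemma T_op_eq:
  assumes [measurable]: "Z \<in> borel_measurable M" "Y \<in> borel_measurable M" "g \<in> borel_measurable borel"
  shows "T_op M Z Y g x = (\<integral>\<^sup>+ \<omega>. g (x - Y \<omega>) * indicator {..x} (Z \<omega>) \<partial>M)"
proof -
  let ?A = "{\<omega> \<in> space M. Z \<omega> \<le> x}"
  have "Y \<in> borel_measurable (restrict_space M ?A)"
    by (intro measurable_restrict_space1) measurable
  then have "T_op M Z Y g x = (\<integral>\<^sup>+ \<omega>. g (x - Y \<omega>) \<partial>restrict_space M ?A)"
    unfolding T_op_def joint_law_def by (subst nn_integral_distr) auto
  also have "\<dots> = (\<integral>\<^sup>+ \<omega>. g (x - Y \<omega>) * indicator ?A \<omega> \<partial>M)"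
    by (rule nn_integral_restrict_space) auto
  also have "\<dots> = (\<integral>\<^sup>+ \<omega>. g (x - Y \<omega>) * indicator {..x} (Z \<omega>) \<partial>M)"
    by (rule nn_integral_cong) (auto split: split_indicator)
  finally show ?thesis .
qed

text \<open>Hence the operator maps nonnegative Borel functions to nonnegative Borel functions.\<close>

lemma borel_measurable_T_op:
  assumes "sigma_finite_measure M"
    and [measurable]: "Z \<in> borel_measurable M" "Y \<in> borel_measurable M" "g \<in> borel_measurable borel"
  shows "T_op M Z Y g \<in> borel_measurable borel"
proof -
  interpret sigma_finite_measure M by fact
  have *: "T_op M Z Y g
      = (\<lambda>x. \<integral>\<^sup>+ \<omega>. g (x - Y \<omega>) * (if Z \<omega> \<le> x then 1 else 0) \<partial>M)"
    by (rule ext) (auto simp: T_op_eq intro!: nn_integral_cong)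
  show ?thesis
    unfolding * by measurable
qed

end

theory Submission
  imports Defs
begin

text \<open>
  Let \<open>u\<^sub>n(x)\<close> be the probability that \<open>S\<^sub>k + \<xi>\<^sub>k > x\<close> for some \<open>k < n\<close>. Conditioning on the first pair
  and using that the remaining sequence of pairs is independent of it and has the same law as the
  whole sequence gives \<open>u\<^sub>n\<^sub>+\<^sub>1 = b + T u\<^sub>n\<close>, so \<open>u\<^sub>n\<close> is the \<open>n\<close>-th partial sum of the
  Neumann series. Continuity from below yields \<open>u\<^sup>* = \<Sum> T\<^sup>n b\<close>, and monotone convergence
  then gives the integral equation.
\<close>

text \<open>Stated on sequences of pairs, with \<open>w k\<close> in the role of the pair
  (\<open>\<xi> k\<close>, \<open>X (Suc k)\<close>), because there dropping the first pair is a
  shift of coordinates. The bound \<open>k<n\<close> makes the value at \<open>n = 0\<close> equal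
  to 0, the empty partial sum.\<close>

definition passage_prob :: "(nat \<Rightarrow> real \<times> real) measure \<Rightarrow> nat \<Rightarrow> real \<Rightarrow> ennreal" where
  "passage_prob P n x = emeasure P {w \<in> space P. \<exists>k<n. x < (\<Sum>i<k. snd (w i)) + fst (w k)}"

text \<open>The pairs carry the Borel sets of the product topology rather than a product
  sigma-algebra, so measurability of the projections is taken from their continuity.\<close>

lemma
  shows borel_measurable_fst: "(fst :: real \<times> real \<Rightarrow> real) \<in> borel_measurable borel"
    and borel_measurable_snd: "(snd :: real \<times> real \<Rightarrow> real) \<in> borel_measurable borel"
  by (intro borel_measurable_continuous_onI continuous_intros)+

text \<open>Prepending an independent pair with law \<open>\<mu>\<close> to a sequence with law
  \<open>P\<close> gives law \<open>P\<close> again (\<open>PiM_iter\<close>). The event is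
  therefore measured by integrating the probabilities of its sections over the first pair
  \<open>z\<close>.\<close>

lemma passage_prob_Suc:
  fixes \<mu> :: "(real \<times> real) measure"
  assumes "prob_space \<mu>" and sets_mu: "sets \<mu> = sets borel"
  defines "P \<equiv> \<Pi>\<^sub>M i\<in>UNIV. \<mu>"
  shows "passage_prob P (Suc n) x
    = (\<integral>\<^sup>+ z. (if x < fst z then 1 else passage_prob P n (x - snd z)) \<partial>\<mu>)"
proof -
  interpret sequence_space \<mu>
    using assms(1)
    by (simp add: sequence_space_def product_prob_space_def product_sigma_finite_def
        product_prob_space_axioms_def prob_space_imp_sigma_finite)
  interpret Q: prob_space P
    unfolding P_def by (intro prob_space_PiM assms(1))
  note sets_mu [measurable_cong]
  have space_mu: "space \<mu> = UNIV"
    using sets_eq_imp_space_eq [OF sets_mu] by simp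
  have [measurable]: "fst \<in> borel_measurable \<mu>" "snd \<in> borel_measurable \<mu>"
    using borel_measurable_fst borel_measurable_snd by (simp_all add: measurable_def sets_mu space_mu)
  have space_P: "space P = UNIV"
    by (simp add: P_def space_PiM space_mu)
  have [measurable]: "(\<lambda>w. w i) \<in> measurable P \<mu>" for i
    unfolding P_def by measurable
  define A where "A = {w \<in> space P. \<exists>k<Suc n. x < (\<Sum>i<k. snd (w i)) + fst (w k)}"
  have A [measurable]: "A \<in> sets P"
    unfolding A_def by measurable
  have shift [measurable]: "(\<lambda>(s, w). case_nat s w) \<in> measurable (\<mu> \<Otimes>\<^sub>M P) P"
    unfolding P_def by measurable
  \<comment> \<open>The index 0 contributes \<open>x < fst z\<close>, the sum being empty. For every
    later index the summand \<open>snd z\<close> is moved to the left, which lowers the level to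
    \<open>x - snd z\<close>.\<close>
  have mem: "case_nat z w \<in> A \<longleftrightarrow>
      x < fst z \<or> (\<exists>k<n. x - snd z < (\<Sum>i<k. snd (w i)) + fst (w k))" for z w
    by (simp add: A_def space_P Ex_less_Suc2 sum.lessThan_Suc_shift algebra_simps
        del: sum.lessThan_Suc)
  have "passage_prob P (Suc n) x = emeasure (distr (\<mu> \<Otimes>\<^sub>M P) P (\<lambda>(s, w). case_nat s w)) A"
    using PiM_iter by (simp add: P_def passage_prob_def A_def)
  also have "\<dots> = emeasure (\<mu> \<Otimes>\<^sub>M P)
      ((\<lambda>(s, w). case_nat s w) -` A \<inter> space (\<mu> \<Otimes>\<^sub>M P))"
    by (rule emeasure_distr [OF shift A])
  also have "\<dots> = (\<integral>\<^sup>+ z. emeasure P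
      (Pair z -` ((\<lambda>(s, w). case_nat s w) -` A \<inter> space (\<mu> \<Otimes>\<^sub>M P))) \<partial>\<mu>)"
    by (rule Q.emeasure_pair_measure_alt) (use measurable_sets [OF shift A] in simp)
  also have "\<dots> = (\<integral>\<^sup>+ z. (if x < fst z then 1 else passage_prob P n (x - snd z)) \<partial>\<mu>)"
  proof (rule nn_integral_cong)
    fix z
    have "Pair z -` ((\<lambda>(s, w). case_nat s w) -` A \<inter> space (\<mu> \<Otimes>\<^sub>M P))
        = {w \<in> space P. case_nat z w \<in> A}"
      by (auto simp: space_pair_measure space_mu)
    then show "emeasure P (Pair z -` ((\<lambda>(s, w). case_nat s w) -` A \<inter> space (\<mu> \<Otimes>\<^sub>M P)))
        = (if x < fst z then 1 else passage_prob P n (x - snd z))"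
      using Q.emeasure_space_1 by (simp add: mem passage_prob_def)
  qed
  finally show ?thesis .
qed

lemma borel_measurable_b_fun:
  assumes "sigma_finite_measure M" and [measurable]: "\<xi> 0 \<in> borel_measurable M"
  shows "b_fun M \<xi> \<in> borel_measurable borel"
proof -
  interpret sigma_finite_measure M by fact
  \<comment> \<open>As an integral of a jointly measurable function of \<open>x\<close> and
    \<open>\<omega>\<close>, this is measurable in \<open>x\<close> by sigma-finiteness of
    \<open>M\<close>.\<close>
  have "b_fun M \<xi> = (\<lambda>x. \<integral>\<^sup>+ \<omega>. (if x < \<xi> 0 \<omega> then 1 else 0) \<partial>M)"
  proof
    fix x
    have "b_fun M \<xi> x = (\<integral>\<^sup>+ \<omega>. indicator {\<omega> \<in> space M. x < \<xi> 0 \<omega>} \<omega> \<partial>M)"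
      by (simp add: b_fun_def)
    also have "\<dots> = (\<integral>\<^sup>+ \<omega>. (if x < \<xi> 0 \<omega> then 1 else 0) \<partial>M)"
      by (rule nn_integral_cong) simp
    finally show "b_fun M \<xi> x = (\<integral>\<^sup>+ \<omega>. (if x < \<xi> 0 \<omega> then 1 else 0) \<partial>M)" .
  qed
  then show ?thesis by simp
qed

lemma borel_measurable_T_op_funpow:
  assumes "sigma_finite_measure M"
    and "Z \<in> borel_measurable M" "Y \<in> borel_measurable M" "g \<in> borel_measurable borel"
  shows "(T_op M Z Y ^^ n) g \<in> borel_measurable borel"
  by (induction n) (simp_all add: assms borel_measurable_T_op)

lemma T_op_suminf:
  assumes [measurable]: "Y \<in> borel_measurable M" "\<And>n. f n \<in> borel_measurable borel"
  shows "T_op M Z Y (\<lambda>x. \<Sum>n. f n x) x = (\<Sum>n. T_op M Z Y (f n) x)"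
  unfolding T_op_def by (rule nn_integral_suminf) (simp add: joint_law_def)

lemma T_op_sum:
  assumes [measurable]: "Y \<in> borel_measurable M" "\<And>n. f n \<in> borel_measurable borel"
  shows "T_op M Z Y (\<lambda>x. \<Sum>n\<in>I. f n x) x = (\<Sum>n\<in>I. T_op M Z Y (f n) x)"
  unfolding T_op_def by (rule nn_integral_sum) (simp add: joint_law_def)

text \<open>After the index shift the \<open>i\<close>-th summand is the second component of the
  \<open>i\<close>-th pair, as in \<open>passage_prob\<close>.\<close>

lemma partial_sum_eq: "partial_sum X k \<omega> = (\<Sum>i<k. X (Suc i) \<omega>)"
  unfolding partial_sum_def by (induction k) simp_all

theorem proposition3:
  fixes M :: "'a measure" and \<xi> X :: "nat \<Rightarrow> 'a \<Rightarrow> real"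
  assumes "prob_space M"
    and "prob_space.indep_vars M (\<lambda>_. borel :: (real \<times> real) measure)
           (\<lambda>j \<omega>. (\<xi> j \<omega>, X (Suc j) \<omega>)) (UNIV :: nat set)"
    and "\<And>j. distr M (borel :: (real \<times> real) measure) (\<lambda>\<omega>. (\<xi> j \<omega>, X (Suc j) \<omega>))
           = distr M borel (\<lambda>\<omega>. (\<xi> 0 \<omega>, X 1 \<omega>))"
  shows "(\<forall>x. u_star M \<xi> X x = b_fun M \<xi> x + T_op M (\<xi> 0) (X 1) (u_star M \<xi> X) x)
       \<and> (\<forall>x. u_star M \<xi> X x = (\<Sum>n. (T_op M (\<xi> 0) (X 1) ^^ n) (b_fun M \<xi>) x))"
proof -
  interpret prob_space M by fact
  define Z where "Z = (\<lambda>j \<omega>. (\<xi> j \<omega>, X (Suc j) \<omega>))"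
  define \<mu> where "\<mu> = distr M borel (Z 0)"
  define P where "P = (\<Pi>\<^sub>M i\<in>(UNIV :: nat set). \<mu>)"
  let ?T = "T_op M (\<xi> 0) (X (Suc 0))" and ?b = "b_fun M \<xi>"
  have indep: "indep_vars (\<lambda>_. borel) Z UNIV"
    using assms(2) by (simp add: Z_def)
  then have Z_meas [measurable]: "Z j \<in> borel_measurable M" for j
    by (simp add: indep_vars_def)
  have [measurable]: "\<xi> j \<in> borel_measurable M" for j
    using measurable_compose [OF Z_meas borel_measurable_fst, of j] by (simp add: Z_def)
  have [measurable]: "X (Suc j) \<in> borel_measurable M" for j
    using measurable_compose [OF Z_meas borel_measurable_snd, of j] by (simp add: Z_def)
  have sets_mu: "sets \<mu> = sets borel"
    by (simp add: \<mu>_def)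
  have prob_mu: "prob_space \<mu>"
    unfolding \<mu>_def by (rule prob_space_distr) simp
  have mu: "distr M borel (Z j) = \<mu>" for j
    using assms(3) [of j] by (simp add: \<mu>_def Z_def)
  have sets_P: "sets P = sets (\<Pi>\<^sub>M i\<in>(UNIV :: nat set). borel)"
    unfolding P_def by (rule sets_PiM_cong) (simp_all add: sets_mu)
  have space_P: "space P = UNIV"
    using sets_eq_imp_space_eq [OF sets_P] by (simp add: space_PiM)
  \<comment> \<open>Independence makes the joint law the product of the laws of the pairs, and
    identical distribution makes each factor \<open>\<mu>\<close>. Any dependence within a pair is
    kept inside \<open>\<mu>\<close>.\<close>
  have law: "distr M P (\<lambda>\<omega> j. Z j \<omega>) = P"
  proof -
    have "distr M (\<Pi>\<^sub>M i\<in>(UNIV :: nat set). borel) (\<lambda>\<omega>. \<lambda>i\<in>UNIV. Z i \<omega>)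
        = (\<Pi>\<^sub>M i\<in>UNIV. distr M borel (Z i))"
      using indep by (subst (asm) indep_vars_iff_distr_eq_PiM) simp_all
    moreover have "distr M P (\<lambda>\<omega> j. Z j \<omega>) = distr M (\<Pi>\<^sub>M i\<in>(UNIV :: nat set). borel) (\<lambda>\<omega> j. Z j \<omega>)"
      by (rule distr_cong) (simp_all add: sets_P)
    ultimately show ?thesis
      by (simp add: mu P_def restrict_def)
  qed
  have [measurable]: "(\<lambda>\<omega> j. Z j \<omega>) \<in> measurable M P"
    by (subst measurable_cong_sets [OF refl sets_P], rule measurable_PiM_single') simp_all
  have [measurable]: "(\<lambda>w. w i) \<in> borel_measurable P" for i
    by (subst measurable_cong_sets [OF sets_P refl]) simp
  have [measurable]: "(\<lambda>w. fst (w i)) \<in> borel_measurable P" "(\<lambda>w. snd (w i)) \<in> borel_measurable P" for i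
    by (rule measurable_compose [OF _ borel_measurable_fst], simp)
       (rule measurable_compose [OF _ borel_measurable_snd], simp)
  define E where "E = (\<lambda>n x. {\<omega> \<in> space M. \<exists>k<n. x < partial_sum X k \<omega> + \<xi> k \<omega>})"
  have E_meas [measurable]: "E n x \<in> sets M" for n x
    unfolding E_def partial_sum_eq by measurable
  have E_prob: "emeasure M (E n x) = passage_prob P n x" for n x
  proof -
    let ?A = "{w \<in> space P. \<exists>k<n. x < (\<Sum>i<k. snd (w i)) + fst (w k)}"
    have "?A \<in> sets P" by measurable
    then have "emeasure (distr M P (\<lambda>\<omega> j. Z j \<omega>)) ?A
        = emeasure M ((\<lambda>\<omega> j. Z j \<omega>) -` ?A \<inter> space M)"
      by (intro emeasure_distr) simp_all
    also have "(\<lambda>\<omega> j. Z j \<omega>) -` ?A \<inter> space M = E n x"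
      by (auto simp: E_def space_P Z_def partial_sum_eq)
    finally show ?thesis
      by (simp add: law passage_prob_def)
  qed

  have b_meas [measurable]: "?b \<in> borel_measurable borel"
    by (rule borel_measurable_b_fun) (simp_all add: sigma_finite_measure_axioms)
  have Tn_meas [measurable]: "(?T ^^ n) ?b \<in> borel_measurable borel" for n
    by (rule borel_measurable_T_op_funpow) (simp_all add: sigma_finite_measure_axioms)

  \<comment> \<open>Measurability of \<open>passage_prob P n\<close> is a premise because it is not
    known in advance: the induction below reads it off the series formula for the same
    \<open>n\<close>.\<close>
  have step: "passage_prob P (Suc n) x = ?b x + ?T (passage_prob P n) x"
    if [measurable]: "passage_prob P n \<in> borel_measurable borel" for n x
  proof -
    have [measurable]: "(\<lambda>z. if x < fst z then 1 else passage_prob P n (x - snd z))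
        \<in> borel_measurable borel"
      by (subst borel_prod [symmetric]) measurable
    have "passage_prob P (Suc n) x
        = (\<integral>\<^sup>+ z. (if x < fst z then 1 else passage_prob P n (x - snd z)) \<partial>\<mu>)"
      unfolding P_def by (rule passage_prob_Suc [OF prob_mu sets_mu])
    also have "\<dots> = (\<integral>\<^sup>+ \<omega>. (if x < \<xi> 0 \<omega> then 1 else passage_prob P n (x - X (Suc 0) \<omega>)) \<partial>M)"
      unfolding \<mu>_def by (subst nn_integral_distr) (simp_all add: Z_def cong: if_cong)
    \<comment> \<open>The two branches live on the complementary events
      \<open>x < \<xi> 0 \<omega>\<close> and \<open>\<xi> 0 \<omega> \<le> x\<close>; the second
      term is the integrand of \<open>T_op_eq\<close>.\<close>
    also have "\<dots> = (\<integral>\<^sup>+ \<omega>. indicator {\<omega> \<in> space M. x < \<xi> 0 \<omega>} \<omega>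
        + passage_prob P n (x - X (Suc 0) \<omega>) * indicator {..x} (\<xi> 0 \<omega>) \<partial>M)"
      by (rule nn_integral_cong) (auto split: split_indicator)
    also have "\<dots> = (\<integral>\<^sup>+ \<omega>. indicator {\<omega> \<in> space M. x < \<xi> 0 \<omega>} \<omega> \<partial>M)
        + (\<integral>\<^sup>+ \<omega>. passage_prob P n (x - X (Suc 0) \<omega>) * indicator {..x} (\<xi> 0 \<omega>) \<partial>M)"
      by (rule nn_integral_add) measurable
    also have "\<dots> = ?b x + ?T (passage_prob P n) x"
      by (simp add: b_fun_def T_op_eq)
    finally show ?thesis .
  qed
  have series: "passage_prob P n = (\<lambda>x. \<Sum>k<n. (?T ^^ k) ?b x)" for n
  proof (induction n)
    case 0
    show ?case by (simp add: passage_prob_def)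
  next
    case (Suc n)
    have meas: "passage_prob P n \<in> borel_measurable borel"
      unfolding Suc.IH by measurable
    show ?case
    proof
      fix x
      have "passage_prob P (Suc n) x = ?b x + ?T (\<lambda>x. \<Sum>k<n. (?T ^^ k) ?b x) x"
        by (subst step [OF meas]) (simp only: Suc.IH)
      also have "\<dots> = ?b x + (\<Sum>k<n. ?T ((?T ^^ k) ?b) x)"
        by (subst T_op_sum) simp_all
      also have "\<dots> = (\<Sum>k<Suc n. (?T ^^ k) ?b x)"
        by (simp add: sum.lessThan_Suc_shift del: sum.lessThan_Suc)
      finally show "passage_prob P (Suc n) x = (\<Sum>k<Suc n. (?T ^^ k) ?b x)" .
    qed
  qed

  have u_series: "u_star M \<xi> X x = (\<Sum>n. (?T ^^ n) ?b x)" for x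
  proof -
    have mono: "incseq (\<lambda>n. E n x)"
      unfolding incseq_def E_def using order_less_le_trans by blast
    \<comment> \<open>A supremum strictly exceeds \<open>x\<close> exactly when some term does,
      whether or not it is attained or finite.\<close>
    have "{\<omega> \<in> space M. perturbed_max \<xi> X \<omega> > ereal x} = (\<Union>n. E n x)"
      by (auto simp: perturbed_max_def E_def less_SUP_iff)
    then have "u_star M \<xi> X x = emeasure M (\<Union>n. E n x)"
      by (simp add: u_star_def)
    also have "\<dots> = (SUP n. emeasure M (E n x))"
      using mono by (intro SUP_emeasure_incseq [symmetric]) auto
    also have "\<dots> = (\<Sum>n. (?T ^^ n) ?b x)"
      by (simp add: E_prob series suminf_eq_SUP)
    finally show ?thesis .
  qed
  have "u_star M \<xi> X x = ?b x + ?T (u_star M \<xi> X) x" for x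
  proof -
    \<comment> \<open>The term \<open>n = 0\<close> is \<open>?b x\<close>; in each later term one
      application of \<open>?T\<close> is then pulled out of the series by
      \<open>T_op_suminf\<close>.\<close>
    have "u_star M \<xi> X x = ?b x + (\<Sum>n. (?T ^^ Suc n) ?b x)"
      unfolding u_series by (subst suminf_offset [of _ 1]) simp_all
    also have "(\<Sum>n. (?T ^^ Suc n) ?b x) = ?T (\<lambda>x. \<Sum>n. (?T ^^ n) ?b x) x"
      by (simp add: T_op_suminf)
    also have "(\<lambda>x. \<Sum>n. (?T ^^ n) ?b x) = u_star M \<xi> X"
      by (simp add: u_series fun_eq_iff)
    finally show ?thesis .
  qed
  \<comment> \<open>The theorem writes \<open>X 1\<close>, while \<open>?T\<close> was set up with
    \<open>X (Suc 0)\<close>, the form produced by the pairs.\<close>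
  with u_series show ?thesis unfolding One_nat_def by blast
qed

end
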